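(* Let $X$ be a (real or complex) Banach space and $C>0$. Suppose that each bounded set $K\subset X''$ satisfies $$\operatorname{wck}_{X''}(K)\leq C\cdot\eta(K).$$ Then for every bounded sequence $(x_n'')$ in $X''$ $$\operatorname{wck}_{X''}\big(\{x_n'':\ n\in\mathbb{N}\}\big)\leq\tfrac12 C\cdot\delta_{w^*}(x_n'').$$
   Context: For a Banach space $Z$, $Z'$ denotes its dual, $Z''$ its bidual, and $B_Z$ its closed unit ball; $Z$ is canonically embedded in $Z''$. For a bounded subset $S$ of a Banach space $Z$, $$\operatorname{wck}_Z(S)=\sup\{\operatorname{dist}(\operatorname{clust}_{(Z'',w^* )}(z_n),Z):\ (z_n)\text{ is a sequence in }S\},$$ where $\operatorname{clust}_{(Z'',w^* )}(z_n)$ is the set of all weak$^*$ cluster points of $(z_n)$ in $Z''$ and $\operatorname{dist}(D,Z)=\inf\{\|d-z\|:\ d\in D,\ z\in Z\}$. In the claim it is used for the Banach space $X''$. For a bounded subset $K$ of a dual space $Z'$, $$\eta(K)=\sup\Big\{\limsup_n\sup_{z'\in K}|z'(z_n)|:\ (z_n)\subset Z,\ \sup_{z'\in B_{Z'}}\sum_{n=1}^\infty|z'(z_n)|\leq1\Big\},$$ and for a bounded sequence $(z_n')$ in $Z'$, $$\delta_{w^*}(z_n')=\sup_{z\in B_Z}\lim_{n\to\infty}\sup_{k,l\geq n}|z_k'(z)-z_l'(z)|.$$ In the claim $\eta$ and $\delta_{w^*}$ are used with $Z=X'$ and $Z'=X''$. *)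

theory Defs
  imports "HOL-Analysis.Analysis"
begin

section \<open>Complex Banach spaces and their duals\<close>

text \<open>
  The dual of a real normed space \<open>'a\<close> is the library type \<open>'a \<Rightarrow>\<^sub>L real\<close>. The library has no class of
  complex normed spaces, and \<open>'a \<Rightarrow>\<^sub>L complex\<close> consists of the bounded \<^emph>\<open>real\<close>-linear maps. Hence the
  following class, and the type of complex-linear functionals with the operator norm.
\<close>

class complex_normed_vector = real_normed_vector +
  fixes scaleC :: "complex \<Rightarrow> 'a \<Rightarrow> 'a" (infixr "*\<^sub>C" 75)
  assumes scaleC_add_right: "c *\<^sub>C (x + y) = c *\<^sub>C x + c *\<^sub>C y"
    and scaleC_add_left: "(c + d) *\<^sub>C x = c *\<^sub>C x + d *\<^sub>C x"
    and scaleC_scaleC: "c *\<^sub>C d *\<^sub>C x = (c * d) *\<^sub>C x"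
    and scaleC_of_real: "complex_of_real r *\<^sub>C x = r *\<^sub>R x"
    and norm_scaleC: "norm (c *\<^sub>C x) = norm c * norm x"

class complex_banach = complex_normed_vector + banach

typedef (overloaded) 'a complex_dual =
  "{f :: 'a::complex_normed_vector \<Rightarrow>\<^sub>L complex.
     \<forall>c x. blinfun_apply f (c *\<^sub>C x) = c * blinfun_apply f x}"
  morphisms blinfun_of_dual dual_of_blinfun
  by (rule exI[of _ 0]) simp

setup_lifting type_definition_complex_dual

lift_definition complex_dual_apply :: "'a::complex_normed_vector complex_dual \<Rightarrow> 'a \<Rightarrow> complex"
  is blinfun_apply .

instantiation complex_dual :: (complex_normed_vector) real_normed_vector
begin

lift_definition norm_complex_dual :: "'a complex_dual \<Rightarrow> real" is norm .

lift_definition zero_complex_dual :: "'a complex_dual" is 0 by simp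

lift_definition plus_complex_dual :: "'a complex_dual \<Rightarrow> 'a complex_dual \<Rightarrow> 'a complex_dual"
  is "(+)" by (simp add: blinfun.add_left algebra_simps)

lift_definition minus_complex_dual :: "'a complex_dual \<Rightarrow> 'a complex_dual \<Rightarrow> 'a complex_dual"
  is "(-)" by (simp add: blinfun.diff_left algebra_simps)

lift_definition uminus_complex_dual :: "'a complex_dual \<Rightarrow> 'a complex_dual"
  is uminus by (simp add: blinfun.minus_left)

lift_definition scaleR_complex_dual :: "real \<Rightarrow> 'a complex_dual \<Rightarrow> 'a complex_dual"
  is scaleR by (simp add: blinfun.scaleR_left)

definition dist_complex_dual :: "'a complex_dual \<Rightarrow> 'a complex_dual \<Rightarrow> real"
  where "dist_complex_dual f g = norm (f - g)"

definition uniformity_complex_dual :: "('a complex_dual \<times> 'a complex_dual) filter"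
  where "uniformity_complex_dual = (INF e\<in>{0 <..}. principal {(f, g). dist f g < e})"

definition open_complex_dual :: "'a complex_dual set \<Rightarrow> bool"
  where "open_complex_dual S = (\<forall>f\<in>S. \<forall>\<^sub>F (f', g) in uniformity. f' = f \<longrightarrow> g \<in> S)"

definition sgn_complex_dual :: "'a complex_dual \<Rightarrow> 'a complex_dual"
  where "sgn_complex_dual f = inverse (norm f) *\<^sub>R f"

instance
proof
  fix f g h :: "'a complex_dual" and a b :: real
  show "f + g + h = f + (g + h)" "f + g = g + f" "0 + f = f" "- f + f = 0" "f - g = f + - g"
    by (transfer; simp)+
  show "a *\<^sub>R (f + g) = a *\<^sub>R f + a *\<^sub>R g" "(a + b) *\<^sub>R f = a *\<^sub>R f + b *\<^sub>R f"
    by (transfer; simp add: algebra_simps)+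
  show "a *\<^sub>R b *\<^sub>R f = (a * b) *\<^sub>R f" "1 *\<^sub>R f = f"
    by (transfer; simp)+
  show "dist f g = norm (f - g)" by (rule dist_complex_dual_def)
  show "sgn f = inverse (norm f) *\<^sub>R f" by (rule sgn_complex_dual_def)
  show "uniformity = (INF e\<in>{0<..}. principal {(x, y). dist x (y :: 'a complex_dual) < e})"
    by (rule uniformity_complex_dual_def)
  show "open U = (\<forall>x\<in>U. \<forall>\<^sub>F (x', y) in uniformity. x' = x \<longrightarrow> y \<in> U)" for U :: "'a complex_dual set"
    by (rule open_complex_dual_def)
  show "norm f = 0 \<longleftrightarrow> f = 0" "norm (a *\<^sub>R f) = \<bar>a\<bar> * norm f"
    by (transfer; simp)+
  show "norm (f + g) \<le> norm f + norm g"
    by transfer (rule norm_triangle_ineq)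
qed

end

instantiation complex_dual :: (complex_normed_vector) complex_normed_vector
begin

lift_definition scaleC_complex_dual :: "complex \<Rightarrow> 'a complex_dual \<Rightarrow> 'a complex_dual"
  is "\<lambda>c f. blinfun_mult_right c o\<^sub>L f" by simp

instance
proof
  fix f g :: "'a complex_dual" and a :: real and c d :: complex
  show "c *\<^sub>C (f + g) = c *\<^sub>C f + c *\<^sub>C g" "(c + d) *\<^sub>C f = c *\<^sub>C f + d *\<^sub>C f"
    by (transfer; auto intro!: blinfun_eqI simp: blinfun.add_left algebra_simps)+
  show "c *\<^sub>C d *\<^sub>C f = (c * d) *\<^sub>C f"
    by (transfer; auto intro!: blinfun_eqI)
  show "complex_of_real a *\<^sub>C f = a *\<^sub>R f"
    by (transfer; auto intro!: blinfun_eqI simp: blinfun.scaleR_left scaleR_conv_of_real)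
  have le: "norm (c *\<^sub>C f) \<le> norm c * norm f" for c and f :: "'a complex_dual"
    by transfer (auto intro!: norm_blinfun_bound simp: norm_mult mult.assoc mult_left_mono norm_blinfun)
  show "norm (c *\<^sub>C f) = norm c * norm f"
  proof (cases "c = 0")
    case True
    then show ?thesis using le[of c f] by simp
  next
    case False
    have "inverse c *\<^sub>C c *\<^sub>C f = f"
      using False by (transfer; auto intro!: blinfun_eqI)
    with le[of "inverse c" "c *\<^sub>C f"] have "norm f \<le> inverse (norm c) * norm (c *\<^sub>C f)"
      by (simp add: norm_inverse)
    with False have "norm c * norm f \<le> norm (c *\<^sub>C f)"
      by (simp add: field_simps)
    with le[of c f] show ?thesis by simp
  qed
qed

end

instance complex_dual :: (complex_normed_vector) complex_banach
proof
  fix F :: "nat \<Rightarrow> 'a complex_dual"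
  assume C: "Cauchy F"
  have dist_eq: "dist (blinfun_of_dual f) (blinfun_of_dual g) = dist f g" for f g :: "'a complex_dual"
    by (simp add: dist_norm norm_complex_dual.rep_eq minus_complex_dual.rep_eq)
  have hom: "blinfun_apply (blinfun_of_dual f) (c *\<^sub>C x) = c * blinfun_apply (blinfun_of_dual f) x"
    for f :: "'a complex_dual" and c x
    using blinfun_of_dual[of f] by simp
  have "Cauchy (\<lambda>n. blinfun_of_dual (F n))"
    using C by (simp add: Cauchy_def dist_eq)
  then obtain L where L: "(\<lambda>n. blinfun_of_dual (F n)) \<longlonglongrightarrow> L"
    using convergent_eq_Cauchy by blast
  have "blinfun_apply L (c *\<^sub>C x) = c * blinfun_apply L x" for c x
  proof (rule LIMSEQ_unique)
    show "(\<lambda>n. blinfun_apply (blinfun_of_dual (F n)) (c *\<^sub>C x)) \<longlonglongrightarrow> blinfun_apply L (c *\<^sub>C x)"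
      by (intro tendsto_intros L)
    have "(\<lambda>n. c * blinfun_apply (blinfun_of_dual (F n)) x) \<longlonglongrightarrow> c * blinfun_apply L x"
      by (intro tendsto_intros L)
    then show "(\<lambda>n. blinfun_apply (blinfun_of_dual (F n)) (c *\<^sub>C x)) \<longlonglongrightarrow> c * blinfun_apply L x"
      by (simp add: hom)
  qed
  then have "blinfun_of_dual (dual_of_blinfun L) = L"
    by (intro dual_of_blinfun_inverse) simp
  with L have "F \<longlonglongrightarrow> dual_of_blinfun L"
    by (simp add: tendsto_iff flip: dist_eq)
  then show "convergent F" by (rule convergentI)
qed

section \<open>Canonical embeddings into the bidual\<close>

definition real_bidual_embedding :: "'a::real_normed_vector \<Rightarrow> (('a \<Rightarrow>\<^sub>L real) \<Rightarrow>\<^sub>L real)"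
  where "real_bidual_embedding x = Blinfun (\<lambda>f. blinfun_apply f x)"

lemma real_bidual_embedding_apply [simp]:
  "blinfun_apply (real_bidual_embedding x) f = blinfun_apply f x"
  by (simp add: real_bidual_embedding_def bounded_linear_Blinfun_apply blinfun.bounded_linear_left)

definition complex_bidual_embedding ::
  "'a::complex_normed_vector \<Rightarrow> 'a complex_dual complex_dual"
  where "complex_bidual_embedding x = dual_of_blinfun (Blinfun (\<lambda>f. complex_dual_apply f x))"

lemma complex_bidual_embedding_apply [simp]:
  "complex_dual_apply (complex_bidual_embedding x) f = complex_dual_apply f x"
proof -
  have "bounded_linear (\<lambda>f. complex_dual_apply f x)"
    by (rule bounded_linear_intro[where K = "norm x"])
      (transfer; simp add: blinfun.add_left blinfun.scaleR_left norm_blinfun)+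
  moreover have "complex_dual_apply (c *\<^sub>C f) x = c * complex_dual_apply f x" for c f
    by transfer simp
  ultimately show ?thesis
    by (simp add: complex_dual_apply.rep_eq[where x = "dual_of_blinfun _"]
        complex_bidual_embedding_def dual_of_blinfun_inverse bounded_linear_Blinfun_apply)
qed

section \<open>The quantities wck, eta and delta\<close>

text \<open>
  To treat both scalar fields at once, the definitions take the evaluation map \<open>ap f z\<close> of a dual
  space \<open>'d\<close> of \<open>'z\<close> as a parameter; it is either \<open>blinfun_apply\<close> or \<open>complex_dual_apply\<close>.
  All quantities take values in \<^typ>\<open>ennreal\<close>, so that suprema of arbitrary sets exist and the
  supremum of the empty set is 0.
\<close>

text \<open>For \<open>ap = blinfun_apply\<close> this is the library's \<^const>\<open>strong_operator_topology\<close>.\<close>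

definition weak_star_topology :: "('d \<Rightarrow> 'z \<Rightarrow> 'k::topological_space) \<Rightarrow> 'd topology"
  where "weak_star_topology ap = pullback_topology UNIV ap euclidean"

definition cluster_points :: "'d topology \<Rightarrow> (nat \<Rightarrow> 'd) \<Rightarrow> 'd set"
  where "cluster_points T x =
    {p \<in> topspace T. \<forall>U. openin T U \<and> p \<in> U \<longrightarrow> (\<exists>\<^sub>F n in sequentially. x n \<in> U)}"

text \<open>Here \<open>'zz\<close> is the bidual of \<open>'z\<close>, with canonical embedding \<open>J\<close>, evaluated on the dual by \<open>ap\<close>.\<close>

definition wck :: "('z \<Rightarrow> 'zz::metric_space) \<Rightarrow> ('zz \<Rightarrow> 'd \<Rightarrow> 'k::topological_space) \<Rightarrow>
    'z set \<Rightarrow> ennreal"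
  where "wck J ap S = (SUP z \<in> {z :: nat \<Rightarrow> 'z. range z \<subseteq> S}.
    INF p \<in> cluster_points (weak_star_topology ap) (\<lambda>n. J (z n)). INF y. ennreal (dist p (J y)))"

definition eta :: "('d::real_normed_vector \<Rightarrow> 'z \<Rightarrow> 'k::real_normed_vector) \<Rightarrow> 'd set \<Rightarrow> ennreal"
  where "eta ap K =
    (SUP z \<in> {z :: nat \<Rightarrow> 'z. (SUP f \<in> cball 0 1. \<Sum>n. ennreal (norm (ap f (z n)))) \<le> 1}.
      limsup (\<lambda>n. SUP f \<in> K. ennreal (norm (ap f (z n)))))"

definition delta_weak_star :: "('d \<Rightarrow> 'z::real_normed_vector \<Rightarrow> 'k::real_normed_vector) \<Rightarrow>
    (nat \<Rightarrow> 'd) \<Rightarrow> ennreal"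
  where "delta_weak_star ap f = (SUP z \<in> cball 0 1.
    lim (\<lambda>n. SUP k \<in> {n..}. SUP l \<in> {n..}. ennreal (norm (ap (f k) z - ap (f l) z))))"

end

theory Submission
  imports Defs
begin

text \<open>
  Since \<open>wck\<close> and \<open>eta\<close> enter the hypothesis for the same set, everything reduces to
  \<open>eta (range x) \<le> 1/2 * delta x\<close> for a bounded sequence \<open>x\<close> in the bidual
  (\<open>eta_range_le_half_delta\<close>); the hypothesis is then applied to \<open>K = range x\<close>.

  To see this inequality, let \<open>(z n)\<close> be a series in the dual that is admissible for \<open>eta\<close>, and let
  \<open>c\<close> be smaller than its contribution \<open>limsup\<^sub>n sup\<^sub>k \<bar>x\<^sub>k(z\<^sub>n)\<bar>\<close>. The \<open>z n\<close> are functionals themselves, so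
  \<open>T a = (\<Sum>n. a n * z n)\<close> converges pointwise for every bounded scalar sequence \<open>a\<close>, and \<open>T\<close> maps
  the unit ball of \<open>\<ell>\<^sup>\<infinity>\<close> into that of the dual (\<open>real_synthesis\<close>, \<open>complex_synthesis\<close>).
  A bidual functional need not commute with these pointwise sums: \<open>x\<^sub>k \<circ> T\<close> is in general only a
  finitely additive measure on \<open>\<nat>\<close>. Hence the gliding hump rests on
  Rosenthal's lemma (\<open>rosenthal_disjointification\<close>) for finitely additive measures. It yields an
  infinite set \<open>M\<close> of indices \<open>n\<close>, each with a \<open>k = \<kappa> n\<close> such that \<open>x\<^sub>k \<circ> T\<close> has mass more than \<open>c\<close>
  at \<open>n\<close> and variation less than \<open>\<epsilon>\<close> on \<open>M - {n}\<close>. Because each single \<open>x\<^sub>k \<circ> T\<close> is bounded, it can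
  serve only finitely many \<open>n\<close>, so \<open>\<kappa> n \<rightarrow> \<infinity>\<close> along \<open>M\<close>.

  The factor \<open>1/2\<close> comes from the freedom of signs: choose \<open>a\<close> with values of modulus 1 on \<open>M\<close> such
  that \<open>x\<^sub>k(T a)\<close>, for \<open>k = \<kappa> n\<close>, is within \<open>\<epsilon>\<close> of \<open>\<bar>x\<^sub>k(z\<^sub>n)\<bar>\<close> for infinitely many \<open>n \<in> M\<close> and within
  \<open>\<epsilon>\<close> of \<open>- \<bar>x\<^sub>k(z\<^sub>n)\<bar>\<close> for infinitely many others (\<open>oscillating_bounded_sequence\<close>). At the
  single point \<open>T a\<close> of the unit ball the sequence \<open>x\<close> then oscillates by at least \<open>2c - 2\<epsilon>\<close>.
\<close>

section \<open>Rosenthal's disjointification lemma\<close>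

lemma infinite_partition_nat:
  fixes N :: "nat set"
  assumes "infinite N"
  shows "\<exists>P :: nat \<Rightarrow> nat set. (\<forall>p. infinite (P p)) \<and> (\<forall>p. P p \<subseteq> N) \<and>
    (\<forall>p q. p \<noteq> q \<longrightarrow> P p \<inter> P q = {})"
proof -
  define g where "g p q = enumerate N (prod_encode (p, q))" for p q
  have inj: "g p q = g p' q' \<longleftrightarrow> p = p' \<and> q = q'" for p q p' q'
    using assms by (simp add: g_def strict_mono_eq strict_mono_enumerate prod_encode_eq)
  show ?thesis
  proof (intro exI[of _ "\<lambda>p. range (g p)"] conjI allI impI)
    show "infinite (range (g p))" for p
      by (rule range_inj_infinite) (simp add: inj_def inj)
    show "range (g p) \<subseteq> N" for p
      using assms by (auto simp: g_def enumerate_in_set)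
    show "range (g p) \<inter> range (g q) = {}" if "p \<noteq> q" for p q
      using that by (auto simp: inj)
  qed
qed

text \<open>
  Here \<open>v k\<close> stands for the variation of the \<open>k\<close>-th measure. The proof, by a partition into
  infinitely many infinite sets, is Kupka's: either some part works, or every part contains a
  \<open>\<kappa> p\<close> whose measure has mass at least \<open>\<epsilon>\<close> on the rest of that part. In the second case this mass
  lies outside \<open>range \<kappa>\<close>, so that passing to \<open>range \<kappa>\<close> lowers all the relevant masses by \<open>\<epsilon>\<close>.
  As they are bounded, this happens only finitely often.
\<close>

lemma rosenthal_disjointification:
  fixes v :: "nat \<Rightarrow> nat set \<Rightarrow> real"
  assumes mono: "\<And>k A A'. A \<subseteq> A' \<Longrightarrow> v k A \<le> v k A'"
    and superadd: "\<And>k A A'. A \<inter> A' = {} \<Longrightarrow> v k A + v k A' \<le> v k (A \<union> A')"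
    and bound: "\<And>k A. v k A \<le> B"
    and "\<epsilon> > 0" "infinite N"
  obtains M where "M \<subseteq> N" "infinite M" "\<And>k. k \<in> M \<Longrightarrow> v k (M - {k}) < \<epsilon>"
proof -
  have *: "\<exists>M\<subseteq>N. infinite M \<and> (\<forall>k\<in>M. v k (M - {k}) < \<epsilon>)"
    if "infinite N" "\<forall>k\<in>N. v k N \<le> real m * \<epsilon>" for m N
    using that
  proof (induction m arbitrary: N)
    case 0
    have "v k (N - {k}) < \<epsilon>" if "k \<in> N" for k
      using mono[of "N - {k}" N k] 0(2) that \<open>\<epsilon> > 0\<close> by fastforce
    with 0(1) show ?case by blast
  next
    case (Suc m)
    obtain P :: "nat \<Rightarrow> nat set" where P: "\<And>p. infinite (P p)"
      "\<And>p. P p \<subseteq> N" "\<And>p q. p \<noteq> q \<Longrightarrow> P p \<inter> P q = {}"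
      using infinite_partition_nat[OF Suc.prems(1)] by metis
    show ?case
    proof (cases "\<exists>p. \<forall>k\<in>P p. v k (P p - {k}) < \<epsilon>")
      case True
      with P(1,2) show ?thesis by blast
    next
      case False
      then have "\<exists>k. k \<in> P p \<and> \<epsilon> \<le> v k (P p - {k})" for p
        by (meson not_less)
      then obtain \<kappa> where \<kappa>: "\<And>p. \<kappa> p \<in> P p" "\<And>p. \<epsilon> \<le> v (\<kappa> p) (P p - {\<kappa> p})"
        by metis
      have uniq: "p = q" if "\<kappa> q \<in> P p" for p q
        using P(3)[of p q] \<kappa>(1)[of q] that by auto
      then have inj: "\<kappa> p = \<kappa> q \<Longrightarrow> p = q" for p q
        using \<kappa>(1)[of q] by metis
      have "v (\<kappa> p) (range \<kappa>) \<le> real m * \<epsilon>" for p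
      proof -
        have disj: "range \<kappa> \<inter> (P p - {\<kappa> p}) = {}"
          using uniq by auto
        have "v (\<kappa> p) (range \<kappa>) + \<epsilon> \<le> v (\<kappa> p) (range \<kappa>) + v (\<kappa> p) (P p - {\<kappa> p})"
          using \<kappa>(2) by simp
        also have "\<dots> \<le> v (\<kappa> p) (range \<kappa> \<union> (P p - {\<kappa> p}))"
          by (rule superadd[OF disj])
        also have "\<dots> \<le> v (\<kappa> p) N"
          using P(2) \<kappa>(1) by (intro mono) blast
        also have "\<dots> \<le> real (Suc m) * \<epsilon>"
          using Suc.prems(2) P(2) \<kappa>(1) by blast
        finally show ?thesis by (simp add: algebra_simps)
      qed
      then have "\<forall>k\<in>range \<kappa>. v k (range \<kappa>) \<le> real m * \<epsilon>"
        by blast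
      moreover have "infinite (range \<kappa>)"
        using inj by (intro range_inj_infinite injI)
      ultimately obtain M where M: "M \<subseteq> range \<kappa>" "infinite M \<and> (\<forall>k\<in>M. v k (M - {k}) < \<epsilon>)"
        using Suc.IH by blast
      have "\<kappa> p \<in> N" for p
        using P(2) \<kappa>(1) by (rule subsetD)
      then have "M \<subseteq> N"
        using M(1) by auto
      with M(2) show ?thesis
        by (intro exI[of _ M]) simp
    qed
  qed
  obtain m :: nat where "B < real m * \<epsilon>"
    using reals_Archimedean3[OF \<open>\<epsilon> > 0\<close>] by blast
  then have "\<forall>k\<in>N. v k N \<le> real m * \<epsilon>"
    using bound by (meson less_imp_le order.trans)
  from *[OF \<open>infinite N\<close> this] that show ?thesis by blast
qed

section \<open>Bounded functionals on bounded sequences\<close>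

definition unit_seqs :: "nat set \<Rightarrow> (nat \<Rightarrow> 'k::real_normed_field) set"
  where "unit_seqs A = {a. (\<forall>n. norm (a n) \<le> 1) \<and> (\<forall>n. n \<notin> A \<longrightarrow> a n = 0)}"

text \<open>
  A bounded linear functional on \<open>\<ell>\<^sup>\<infinity>\<close>, encoded as a function on all scalar sequences whose values
  matter on bounded ones only. Linearity is required for arbitrary combinations of sequences in the
  unit ball, which span \<open>\<ell>\<^sup>\<infinity>\<close>. The scalar field stays abstract in order to cover \<open>\<real>\<close> and
  \<open>\<complex>\<close> together.
\<close>

locale linf_functional =
  fixes \<nu> :: "(nat \<Rightarrow> 'k::real_normed_field) \<Rightarrow> 'k" and B :: real
  assumes linear: "\<lbrakk>\<And>n. norm (a n) \<le> 1; \<And>n. norm (b n) \<le> 1\<rbrakk>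
      \<Longrightarrow> \<nu> (\<lambda>n. c * a n + d * b n) = c * \<nu> a + d * \<nu> b"
    and bound: "(\<And>n. norm (a n) \<le> 1) \<Longrightarrow> norm (\<nu> a) \<le> B"
begin

text \<open>
  With \<open>\<nu>\<close> read as a finitely additive measure on \<open>\<nat>\<close>, this is its total variation on \<open>A\<close>; as the norm
  of a restricted functional it avoids all measure theory.
\<close>

definition variation :: "nat set \<Rightarrow> real"
  where "variation A = (SUP a\<in>unit_seqs A. norm (\<nu> a))"

lemma zero_in_unit_seqs: "(\<lambda>_. 0) \<in> unit_seqs A"
  by (simp add: unit_seqs_def)

lemma bdd_above_variation: "bdd_above ((\<lambda>a. norm (\<nu> a)) ` unit_seqs A)"
  using bound by (intro bdd_aboveI2[where M = B]) (auto simp: unit_seqs_def)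

lemma norm_le_variation: "a \<in> unit_seqs A \<Longrightarrow> norm (\<nu> a) \<le> variation A"
  unfolding variation_def by (rule cSUP_upper[OF _ bdd_above_variation])

lemma variation_le: "(\<And>a. a \<in> unit_seqs A \<Longrightarrow> norm (\<nu> a) \<le> r) \<Longrightarrow> variation A \<le> r"
  unfolding variation_def using zero_in_unit_seqs by (intro cSUP_least) auto

lemma variation_mono: "A \<subseteq> A' \<Longrightarrow> variation A \<le> variation A'"
  by (intro variation_le norm_le_variation) (auto simp: unit_seqs_def)

lemma variation_le_bound: "variation A \<le> B"
  using bound by (intro variation_le) (auto simp: unit_seqs_def)

lemma variation_nonneg: "0 \<le> variation A"
  using norm_le_variation[OF zero_in_unit_seqs] norm_ge_zero order.trans by blast

text \<open>
  Two sequences that nearly attain the variation on disjoint sets can be rotated to give positive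
  values; their sum is still in the unit ball because the supports are disjoint.
\<close>

lemma variation_superadditive:
  assumes "A \<inter> A' = {}"
  shows "variation A + variation A' \<le> variation (A \<union> A')"
proof -
  have rotate: "\<exists>u. norm u = 1 \<and> u * w = of_real (norm w)" for w :: 'k
    by (cases "w = 0")
      (auto intro: exI[of _ 1] exI[of _ "of_real (norm w) / w"] simp: norm_divide)
  have *: "norm (\<nu> a) + norm (\<nu> b) \<le> variation (A \<union> A')"
    if a: "a \<in> unit_seqs A" and b: "b \<in> unit_seqs A'" for a b
  proof -
    obtain u w where u: "norm u = 1" "u * \<nu> a = of_real (norm (\<nu> a))"
      and w: "norm w = 1" "w * \<nu> b = of_real (norm (\<nu> b))"
      using rotate by metis
    have "\<nu> (\<lambda>n. u * a n + w * b n) = of_real (norm (\<nu> a) + norm (\<nu> b))"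
      using a b u w by (subst linear) (auto simp: unit_seqs_def)
    then have "norm (\<nu> a) + norm (\<nu> b) = norm (\<nu> (\<lambda>n. u * a n + w * b n))"
      by (metis abs_of_nonneg add_nonneg_nonneg norm_ge_zero norm_of_real)
    also have "(\<lambda>n. u * a n + w * b n) \<in> unit_seqs (A \<union> A')"
    proof -
      have "norm (u * a n + w * b n) \<le> 1" for n
        using a b u w assms by (cases "n \<in> A") (auto simp: unit_seqs_def norm_mult disjoint_iff)
      then show ?thesis using a b by (auto simp: unit_seqs_def)
    qed
    then have "norm (\<nu> (\<lambda>n. u * a n + w * b n)) \<le> variation (A \<union> A')"
      by (rule norm_le_variation)
    finally show ?thesis .
  qed
  have "variation A \<le> variation (A \<union> A') - norm (\<nu> b)" if "b \<in> unit_seqs A'" for b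
    using *[OF _ that] by (intro variation_le) (simp add: le_diff_eq)
  then have "variation A' \<le> variation (A \<union> A') - variation A"
    by (intro variation_le) (simp add: algebra_simps)
  then show ?thesis by simp
qed

lemma indicator_in_unit_seqs: "indicator {n} \<in> unit_seqs {n}"
  by (auto simp: unit_seqs_def indicator_def)

text \<open>By superadditivity, \<open>m\<close> such coordinates would force \<open>m * c \<le> B\<close>.\<close>

lemma finite_large_coordinates:
  assumes "c > 0"
  shows "finite {n. c < norm (\<nu> (indicator {n}))}"
proof (rule ccontr)
  assume inf: "infinite {n. c < norm (\<nu> (indicator {n}))}"
  obtain m :: nat where m: "B < real m * c"
    using reals_Archimedean3[OF \<open>c > 0\<close>] by blast
  obtain F where F: "F \<subseteq> {n. c < norm (\<nu> (indicator {n}))}" "finite F" "card F = m"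
    using infinite_arbitrarily_large[OF inf] by metis
  have "real (card F) * c \<le> variation F"
    using F(2,1)
  proof (induction F)
    case empty
    show ?case by (simp add: variation_nonneg)
  next
    case (insert n F)
    have "c \<le> variation {n}"
      using insert.prems norm_le_variation[OF indicator_in_unit_seqs, of n] by simp
    moreover have "variation {n} + variation F \<le> variation (insert n F)"
      using insert.hyps variation_superadditive[of "{n}" F] by simp
    ultimately show ?case
      using insert by (simp add: algebra_simps)
  qed
  then show False
    using m F(3) variation_le_bound[of F] by simp
qed

lemma single_coordinate_approx:
  assumes "a \<in> unit_seqs M" "n \<in> M"
  shows "norm (\<nu> a - a n * \<nu> (indicator {n})) \<le> variation (M - {n})"
proof -
  define r where "r = (\<lambda>m. if m = n then 0 else a m)"
  have r: "r \<in> unit_seqs (M - {n})"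
    using assms by (auto simp: r_def unit_seqs_def)
  have "a = (\<lambda>m. a n * indicator {n} m + 1 * r m)"
    by (auto simp: r_def indicator_def)
  then have "\<nu> a = \<nu> (\<lambda>m. a n * indicator {n} m + 1 * r m)"
    by (rule arg_cong)
  also have "\<dots> = a n * \<nu> (indicator {n}) + 1 * \<nu> r"
    using r by (intro linear) (auto simp: unit_seqs_def indicator_def)
  finally show ?thesis
    using norm_le_variation[OF r] by simp
qed

end

text \<open>
  A quantitative form of Phillips' lemma, with the sharp constant 2: if the point masses of \<open>\<nu> k\<close> do
  not become uniformly small, the \<open>\<nu> k\<close> cannot converge pointwise on the unit ball of \<open>\<ell>\<^sup>\<infinity>\<close>.
\<close>

lemma oscillating_bounded_sequence:
  fixes \<nu> :: "nat \<Rightarrow> (nat \<Rightarrow> 'k::real_normed_field) \<Rightarrow> 'k"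
  assumes func: "\<And>k. linf_functional (\<nu> k) B"
    and "c > 0" "\<epsilon> > 0"
    and large: "\<exists>\<^sub>F n in sequentially. \<exists>k. c < norm (\<nu> k (indicator {n}))"
  shows "\<exists>a. (\<forall>n. norm (a n) \<le> 1) \<and>
    (\<forall>N. \<exists>k\<ge>N. \<exists>l\<ge>N. 2 * c - 2 * \<epsilon> \<le> norm (\<nu> k a - \<nu> l a))"
proof -
  define L where "L = {n. \<exists>k. c < norm (\<nu> k (indicator {n}))}"
  have "infinite L"
    using large by (simp add: L_def frequently_cofinite flip: cofinite_eq_sequentially)
  have "\<forall>n\<in>L. \<exists>k. c < norm (\<nu> k (indicator {n}))"
    by (simp add: L_def)
  from bchoice[OF this] obtain \<kappa> where \<kappa>: "\<forall>n\<in>L. c < norm (\<nu> (\<kappa> n) (indicator {n}))" ..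
  have fin: "finite {n\<in>L. \<kappa> n < N}" for N
  proof (rule finite_subset)
    show "{n\<in>L. \<kappa> n < N} \<subseteq> (\<Union>k<N. {n. c < norm (\<nu> k (indicator {n}))})"
      using \<kappa> by blast
    show "finite (\<Union>k<N. {n. c < norm (\<nu> k (indicator {n}))})"
      using linf_functional.finite_large_coordinates[OF func \<open>c > 0\<close>] by blast
  qed
  have late: "\<exists>n\<in>A. N \<le> \<kappa> n" if "infinite A" "A \<subseteq> L" for A N
  proof (rule ccontr)
    assume "\<not> (\<exists>n\<in>A. N \<le> \<kappa> n)"
    with that(2) have "A \<subseteq> {n\<in>L. \<kappa> n < N}"
      by (auto simp: not_le)
    with fin[of N] that(1) show False
      using finite_subset by blast
  qed
  define v where "v n = linf_functional.variation (\<nu> (\<kappa> n))" for n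
  obtain M where M: "M \<subseteq> L" "infinite M" "\<And>n. n \<in> M \<Longrightarrow> v n (M - {n}) < \<epsilon>"
  proof (rule rosenthal_disjointification[where v = v and B = B and N = L and \<epsilon> = \<epsilon>])
    show "A \<subseteq> A' \<Longrightarrow> v k A \<le> v k A'" for k A A'
      unfolding v_def by (rule linf_functional.variation_mono[OF func])
    show "A \<inter> A' = {} \<Longrightarrow> v k A + v k A' \<le> v k (A \<union> A')" for k A A'
      unfolding v_def by (rule linf_functional.variation_superadditive[OF func])
    show "v k A \<le> B" for k A
      unfolding v_def by (rule linf_functional.variation_le_bound[OF func])
  qed (use \<open>\<epsilon> > 0\<close> \<open>infinite L\<close> in auto)
  obtain P :: "nat \<Rightarrow> nat set" where P: "\<And>p. infinite (P p)"
    "\<And>p. P p \<subseteq> M" "\<And>p q. p \<noteq> q \<Longrightarrow> P p \<inter> P q = {}"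
    using infinite_partition_nat[OF M(2)] by metis
  \<comment> \<open>The factor \<open>norm (w n) / w n\<close> turns the point mass \<open>w n\<close> into its modulus, and \<open>s\<close> separates the
    humps in \<open>P 0\<close> from the other ones, of which \<open>P 1\<close> contains infinitely many.\<close>
  define w where "w n = \<nu> (\<kappa> n) (indicator {n})" for n
  define s :: "nat \<Rightarrow> 'k" where "s n = (if n \<in> P 0 then 1 else - 1)" for n
  define a where "a n = (if n \<in> M then s n * of_real (norm (w n)) / w n else 0)" for n
  have w: "c < norm (w n)" if "n \<in> M" for n
    using \<kappa> M(1) that by (auto simp: w_def)
  have norm_a: "norm (a n) \<le> 1" for n
    by (auto simp: a_def s_def norm_mult norm_divide)
  have approx: "norm (\<nu> (\<kappa> n) a - s n * of_real (norm (w n))) < \<epsilon>" if n: "n \<in> M" for n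
  proof -
    have "a n * \<nu> (\<kappa> n) (indicator {n}) = s n * of_real (norm (w n))"
      using n w[OF n] \<open>c > 0\<close> by (auto simp: a_def simp flip: w_def)
    moreover have "a \<in> unit_seqs M"
      using norm_a by (auto simp: unit_seqs_def a_def)
    ultimately show ?thesis
      using linf_functional.single_coordinate_approx[OF func, of a M n "\<kappa> n"] n M(3)[OF n]
      by (simp add: v_def)
  qed
  show ?thesis
  proof (intro exI[of _ a] conjI allI)
    show "norm (a n) \<le> 1" for n by (rule norm_a)
    show "\<exists>k\<ge>N. \<exists>l\<ge>N. 2 * c - 2 * \<epsilon> \<le> norm (\<nu> k a - \<nu> l a)" for N
    proof -
      obtain i where i: "i \<in> P 0" "N \<le> \<kappa> i"
        using late[of "P 0" N] P M(1) by blast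
      obtain j where j: "j \<in> P 1" "N \<le> \<kappa> j"
        using late[of "P 1" N] P M(1) by blast
      have iM: "i \<in> M" and jM: "j \<in> M" and s: "s i = 1" "s j = - 1"
        using i j P(2) P(3)[of 0 1] by (auto simp: s_def)
      have "norm (w i) + norm (w j) = norm (of_real (norm (w i) + norm (w j)) :: 'k)"
        by (simp only: norm_of_real) simp
      also have "(of_real (norm (w i) + norm (w j)) :: 'k)
          = (\<nu> (\<kappa> i) a - \<nu> (\<kappa> j) a) - (\<nu> (\<kappa> i) a - s i * of_real (norm (w i)))
            + (\<nu> (\<kappa> j) a - s j * of_real (norm (w j)))"
        by (simp add: s)
      also have "norm \<dots> \<le> norm (\<nu> (\<kappa> i) a - \<nu> (\<kappa> j) a)
          + norm (\<nu> (\<kappa> i) a - s i * of_real (norm (w i)))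
          + norm (\<nu> (\<kappa> j) a - s j * of_real (norm (w j)))"
        by (meson add_mono norm_triangle_ineq norm_triangle_ineq4 order.refl order.trans)
      also have "\<dots> \<le> norm (\<nu> (\<kappa> i) a - \<nu> (\<kappa> j) a) + \<epsilon> + \<epsilon>"
        using approx[OF iM] approx[OF jM] by simp
      finally show ?thesis
        using w[OF iM] w[OF jM] i j by (intro exI[of _ "\<kappa> i"] exI[of _ "\<kappa> j"] conjI) auto
    qed
  qed
qed

section \<open>Comparing eta and delta\<close>

lemma le_delta_weak_star:
  assumes z: "norm z \<le> 1"
    and osc: "\<And>N. \<exists>k\<ge>N. \<exists>l\<ge>N. r \<le> norm (ap (x k) z - ap (x l) z)"
  shows "ennreal r \<le> delta_weak_star ap x"
proof -
  define D where "D n = (SUP k\<in>{n..}. SUP l\<in>{n..}. ennreal (norm (ap (x k) z - ap (x l) z)))" for n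
  have "decseq D"
    unfolding D_def by (intro decseq_SucI SUP_subset_mono) auto
  then have "lim D = (INF n. D n)"
    by (intro limI LIMSEQ_INF)
  moreover have "ennreal r \<le> D n" for n
  proof -
    obtain k l where "k \<ge> n" "l \<ge> n" "r \<le> norm (ap (x k) z - ap (x l) z)"
      using osc by blast
    then show ?thesis
      unfolding D_def by (intro SUP_upper2[of k] SUP_upper2[of l]) (auto intro: ennreal_leI)
  qed
  ultimately have "ennreal r \<le> lim D"
    by (simp add: INF_greatest)
  also have "lim D \<le> delta_weak_star ap x"
    unfolding delta_weak_star_def D_def using z by (intro SUP_upper) auto
  finally show ?thesis .
qed

text \<open>
  The assumption \<open>synthesis\<close> is where it matters that \<open>'z\<close> is a dual space: in a general normed space
  the series \<open>\<Sum>n. a n * z n\<close> need not have a sum for all bounded \<open>a\<close>.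
\<close>

lemma eta_range_le_half_delta:
  fixes ap :: "'d::real_normed_vector \<Rightarrow> 'z::real_normed_vector \<Rightarrow> 'k::real_normed_field"
  assumes norm_ap: "\<And>f z. norm (ap f z) \<le> norm f * norm z"
    and synthesis: "\<And>z. (SUP f \<in> cball 0 1. \<Sum>n. ennreal (norm (ap f (z n)))) \<le> 1 \<Longrightarrow>
      \<exists>T. (\<forall>n. T (indicator {n}) = z n) \<and>
        (\<forall>a. (\<forall>n. norm (a n) \<le> 1) \<longrightarrow> norm (T a) \<le> 1) \<and>
        (\<forall>f a b c d. (\<forall>n. norm (a n) \<le> 1) \<longrightarrow> (\<forall>n. norm (b n) \<le> 1) \<longrightarrow>
          ap f (T (\<lambda>n. c * a n + d * b n)) = c * ap f (T a) + d * ap f (T b))"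
    and "bounded (range x)"
  shows "eta ap (range x) \<le> ennreal (1/2) * delta_weak_star ap x"
  unfolding eta_def
proof (rule SUP_least, rule ccontr)
  fix z :: "nat \<Rightarrow> 'z"
  assume "z \<in> {z. (SUP f \<in> cball 0 1. \<Sum>n. ennreal (norm (ap f (z n)))) \<le> 1}"
  then have "(SUP f \<in> cball 0 1. \<Sum>n. ennreal (norm (ap f (z n)))) \<le> 1"
    by simp
  from synthesis[OF this] obtain T where T: "\<And>n. T (indicator {n}) = z n"
    "\<And>a. (\<And>n. norm (a n) \<le> 1) \<Longrightarrow> norm (T a) \<le> 1"
    "\<And>f a b c d. (\<And>n. norm (a n) \<le> 1) \<Longrightarrow> (\<And>n. norm (b n) \<le> 1) \<Longrightarrow>
      ap f (T (\<lambda>n. c * a n + d * b n)) = c * ap f (T a) + d * ap f (T b)"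
    by blast
  assume "\<not> limsup (\<lambda>n. SUP f\<in>range x. ennreal (norm (ap f (z n))))
    \<le> ennreal (1/2) * delta_weak_star ap x"
  \<comment> \<open>Two numbers in the gap: \<open>c\<close> (for \<open>e\<close>) bounds the humps from below, and the remaining room
    \<open>c - b\<close> is the error \<open>\<epsilon>\<close> that may be lost, as \<open>2c - 2\<epsilon> = 2b\<close> still exceeds delta.\<close>
  then obtain e where e: "ennreal (1/2) * delta_weak_star ap x < e"
    "e < limsup (\<lambda>n. SUP f\<in>range x. ennreal (norm (ap f (z n))))"
    by (meson dense not_le)
  obtain b where b: "ennreal (1/2) * delta_weak_star ap x < ennreal b" "ennreal b < e" "b \<ge> 0"
    using dense[OF e(1)] by (metis ennreal_cases infinity_ennreal_def not_less top_greatest)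
  obtain c where c: "e = ennreal c" "b < c"
    using e(2) b(2,3) by (cases e) (auto simp: ennreal_less_iff)
  have large: "\<exists>\<^sub>F n in sequentially. \<exists>k. c < norm (ap (x k) (z n))"
  proof -
    have "\<not> (\<forall>\<^sub>F n in sequentially. (SUP f\<in>range x. ennreal (norm (ap f (z n)))) \<le> ennreal c)"
    proof
      assume "\<forall>\<^sub>F n in sequentially. (SUP f\<in>range x. ennreal (norm (ap f (z n)))) \<le> ennreal c"
      from Limsup_bounded[OF this] show False
        using e(2) unfolding c(1) by simp
    qed
    then have "\<exists>\<^sub>F n in sequentially. ennreal c < (SUP f\<in>range x. ennreal (norm (ap f (z n))))"
      by (simp add: frequently_def not_less)
    then show ?thesis
      by (rule frequently_elim1) (use b(3) c(2) in \<open>auto simp: less_SUP_iff ennreal_less_iff\<close>)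
  qed
  obtain B where B: "\<And>k. norm (x k) \<le> B"
    using \<open>bounded (range x)\<close> by (auto simp: bounded_iff)
  have func: "linf_functional (\<lambda>a. ap (x k) (T a)) B" for k
  proof
    show "norm (ap (x k) (T a)) \<le> B" if "\<And>n. norm (a n) \<le> 1" for a
    proof -
      have "norm (ap (x k) (T a)) \<le> norm (x k) * norm (T a)" by (rule norm_ap)
      also have "\<dots> \<le> norm (x k) * 1" by (intro mult_left_mono T(2) that) auto
      also have "\<dots> \<le> B" using B by simp
      finally show ?thesis .
    qed
  qed (rule T(3))
  have "\<exists>\<^sub>F n in sequentially. \<exists>k. c < norm (ap (x k) (T (indicator {n})))"
    using large by (simp add: T(1))
  from oscillating_bounded_sequence[OF func _ _ this, of "c - b"] b c
  obtain a where "(\<forall>n. norm (a n) \<le> 1) \<and>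
      (\<forall>N. \<exists>k\<ge>N. \<exists>l\<ge>N. 2 * c - 2 * (c - b) \<le> norm (ap (x k) (T a) - ap (x l) (T a)))"
    by auto
  then have a: "\<And>n. norm (a n) \<le> 1"
    "\<And>N. \<exists>k\<ge>N. \<exists>l\<ge>N. 2 * c - 2 * (c - b) \<le> norm (ap (x k) (T a) - ap (x l) (T a))"
    by simp_all
  have "ennreal (2 * c - 2 * (c - b)) \<le> delta_weak_star ap x"
  proof (rule le_delta_weak_star)
    show "norm (T a) \<le> 1"
      using a(1) by (rule T(2))
  qed (rule a(2))
  then have "ennreal (1/2) * ennreal (2 * b) \<le> ennreal (1/2) * delta_weak_star ap x"
    by (intro mult_left_mono) auto
  moreover have "ennreal (1/2) * ennreal (2 * b) = ennreal b"
    using b(3) by (subst ennreal_mult[symmetric]) auto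
  ultimately show False
    using b(1) by simp
qed

section \<open>Pointwise sums of weakly unconditionally Cauchy series\<close>

definition pointwise_sum ::
  "(nat \<Rightarrow> 'a::real_normed_vector \<Rightarrow>\<^sub>L 'k::{real_normed_field,banach}) \<Rightarrow> (nat \<Rightarrow> 'k) \<Rightarrow> 'a \<Rightarrow>\<^sub>L 'k"
  where "pointwise_sum z a = Blinfun (\<lambda>x. \<Sum>n. a n * blinfun_apply (z n) x)"

text \<open>
  The assumption is the condition in \<open>eta\<close>, restricted to the evaluations at points of the predual
  instead of all functionals on the dual; this is enough for the sums to exist.
\<close>

context
  fixes z :: "nat \<Rightarrow> 'a::real_normed_vector \<Rightarrow>\<^sub>L 'k::{real_normed_field,banach}"
  assumes pointwise: "\<And>x. (\<Sum>n. ennreal (norm (blinfun_apply (z n) x))) \<le> ennreal (norm x)"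
begin

lemma summable_pointwise: "summable (\<lambda>n. norm (blinfun_apply (z n) x))"
  using pointwise[of x] by (intro summable_suminf_not_top) (auto simp: top_unique)

lemma suminf_pointwise_le: "(\<Sum>n. norm (blinfun_apply (z n) x)) \<le> norm x"
  using pointwise[of x] summable_pointwise
  by (simp add: suminf_ennreal2 suminf_nonneg)

context
  fixes a :: "nat \<Rightarrow> 'k" and K :: real
  assumes a: "\<And>n. norm (a n) \<le> K"
begin

lemma norm_term_le: "norm (a n * blinfun_apply (z n) x) \<le> K * norm (blinfun_apply (z n) x)"
  using mult_right_mono[OF a norm_ge_zero] by (simp add: norm_mult)

lemma summable_weighted: "summable (\<lambda>n. a n * blinfun_apply (z n) x)"
  using norm_term_le by (intro summable_comparison_test'[OF summable_mult[OF summable_pointwise], of 0]) auto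

lemma norm_suminf_weighted: "norm (\<Sum>n. a n * blinfun_apply (z n) x) \<le> K * norm x"
proof -
  have "K \<ge> 0"
    using a[of 0] norm_ge_zero order.trans by blast
  have "summable (\<lambda>n. norm (a n * blinfun_apply (z n) x))"
    using norm_term_le by (intro summable_comparison_test'[OF summable_mult[OF summable_pointwise], of 0]) auto
  then have "norm (\<Sum>n. a n * blinfun_apply (z n) x) \<le> (\<Sum>n. K * norm (blinfun_apply (z n) x))"
    by (intro order.trans[OF summable_norm] suminf_le norm_term_le summable_mult summable_pointwise)
  also have "\<dots> \<le> K * norm x"
    using suminf_pointwise_le \<open>K \<ge> 0\<close>
    by (simp add: suminf_mult summable_pointwise mult_left_mono)
  finally show ?thesis .
qed

lemma pointwise_sum_apply:
  "blinfun_apply (pointwise_sum z a) x = (\<Sum>n. a n * blinfun_apply (z n) x)"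
proof -
  have "bounded_linear (\<lambda>x. \<Sum>n. a n * blinfun_apply (z n) x)"
  proof (rule bounded_linear_intro[where K = K])
    fix x y and r :: real
    show "(\<Sum>n. a n * blinfun_apply (z n) (x + y))
        = (\<Sum>n. a n * blinfun_apply (z n) x) + (\<Sum>n. a n * blinfun_apply (z n) y)"
      by (simp add: blinfun.add_right distrib_left suminf_add summable_weighted)
    show "(\<Sum>n. a n * blinfun_apply (z n) (r *\<^sub>R x)) = r *\<^sub>R (\<Sum>n. a n * blinfun_apply (z n) x)"
      by (simp add: blinfun.scaleR_right suminf_scaleR_right summable_weighted)
    show "norm (\<Sum>n. a n * blinfun_apply (z n) x) \<le> norm x * K"
      using norm_suminf_weighted by (simp add: mult.commute)
  qed
  then show ?thesis
    by (simp add: pointwise_sum_def bounded_linear_Blinfun_apply)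
qed

lemma norm_pointwise_sum: "norm (pointwise_sum z a) \<le> K"
proof (rule norm_blinfun_bound)
  show "0 \<le> K"
    using a[of 0] norm_ge_zero order.trans by blast
qed (simp add: pointwise_sum_apply norm_suminf_weighted)

end

lemma pointwise_sum_indicator: "pointwise_sum z (indicator {n}) = z n"
proof (rule blinfun_eqI)
  fix x
  have "blinfun_apply (pointwise_sum z (indicator {n})) x
      = (\<Sum>m. indicator {n} m * blinfun_apply (z m) x)"
    by (rule pointwise_sum_apply[where K = 1]) (simp add: indicator_def)
  also have "\<dots> = (\<Sum>m\<in>{n}. indicator {n} m * blinfun_apply (z m) x)"
    by (rule suminf_finite) auto
  finally show "blinfun_apply (pointwise_sum z (indicator {n})) x = blinfun_apply (z n) x"
    by simp
qed

lemma pointwise_sum_linear_apply: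
  assumes a: "\<And>n. norm (a n) \<le> 1" and b: "\<And>n. norm (b n) \<le> 1"
  shows "blinfun_apply (pointwise_sum z (\<lambda>n. c * a n + d * b n)) x
    = c * blinfun_apply (pointwise_sum z a) x + d * blinfun_apply (pointwise_sum z b) x"
proof -
  have "norm (c * a n + d * b n) \<le> norm c + norm d" for n
    using mult_left_le[OF a norm_ge_zero[of c]] mult_left_le[OF b norm_ge_zero[of d]]
    by (intro norm_triangle_le) (simp add: norm_mult add_mono)
  then have "blinfun_apply (pointwise_sum z (\<lambda>n. c * a n + d * b n)) x
      = (\<Sum>n. c * (a n * blinfun_apply (z n) x) + d * (b n * blinfun_apply (z n) x))"
    by (subst pointwise_sum_apply) (auto simp: algebra_simps)
  also have "\<dots> = c * blinfun_apply (pointwise_sum z a) x + d * blinfun_apply (pointwise_sum z b) x"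
    using summable_weighted[OF a] summable_weighted[OF b]
    by (simp add: pointwise_sum_apply[OF a] pointwise_sum_apply[OF b] suminf_mult
        summable_mult flip: suminf_add)
  finally show ?thesis .
qed

end

lemma suminf_evaluation_le:
  fixes ap :: "'d::real_normed_vector \<Rightarrow> 'z \<Rightarrow> 'k::real_normed_vector"
  assumes unit: "(SUP f \<in> cball 0 1. \<Sum>n. ennreal (norm (ap f (z n)))) \<le> 1"
    and scale: "\<And>r u. ap (r *\<^sub>R f) u = r *\<^sub>R ap f u"
    and "norm f \<le> K"
  shows "(\<Sum>n. ennreal (norm (ap f (z n)))) \<le> ennreal K"
proof (cases "f = 0")
  case True
  then have "ap f u = 0" for u
    using scale[of 0 u] by simp
  then show ?thesis by simp
next
  case False
  define g where "g = inverse (norm f) *\<^sub>R f"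
  have "g \<in> cball 0 1"
    using False by (simp add: g_def)
  then have g: "(\<Sum>n. ennreal (norm (ap g (z n)))) \<le> 1"
    using unit by (meson SUP_le_iff)
  have "ennreal (norm (ap f u)) = ennreal (norm f) * ennreal (norm (ap g u))" for u
    using False by (simp add: g_def scale flip: ennreal_mult)
  then have "(\<Sum>n. ennreal (norm (ap f (z n)))) = ennreal (norm f) * (\<Sum>n. ennreal (norm (ap g (z n))))"
    by (simp add: ennreal_suminf_cmult)
  also have "\<dots> \<le> ennreal K * 1"
    using g \<open>norm f \<le> K\<close> by (intro mult_mono ennreal_leI) auto
  finally show ?thesis by simp
qed

text \<open>
  The canonical embedding of \<open>x\<close> in the bidual has norm at most \<open>norm x\<close>, so the condition in \<open>eta\<close>
  controls the series \<open>z n x\<close> and \<open>pointwise_sum z\<close> is the required operator.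
\<close>

lemma real_synthesis:
  fixes z :: "nat \<Rightarrow> 'a::real_normed_vector \<Rightarrow>\<^sub>L real"
  assumes "(SUP f \<in> (cball 0 1 :: (('a \<Rightarrow>\<^sub>L real) \<Rightarrow>\<^sub>L real) set).
    \<Sum>n. ennreal (norm (blinfun_apply f (z n)))) \<le> 1"
  shows "\<exists>T. (\<forall>n. T (indicator {n}) = z n) \<and>
    (\<forall>a. (\<forall>n. norm (a n) \<le> 1) \<longrightarrow> norm (T a) \<le> 1) \<and>
    (\<forall>(f :: ('a \<Rightarrow>\<^sub>L real) \<Rightarrow>\<^sub>L real) a b c d. (\<forall>n. norm (a n) \<le> 1) \<longrightarrow> (\<forall>n. norm (b n) \<le> 1) \<longrightarrow>
      blinfun_apply f (T (\<lambda>n. c * a n + d * b n))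
        = c * blinfun_apply f (T a) + d * blinfun_apply f (T b))"
proof -
  have pw: "(\<Sum>n. ennreal (norm (blinfun_apply (z n) x))) \<le> ennreal (norm x)" for x
  proof -
    have "norm (blinfun_apply (real_bidual_embedding x) f) \<le> norm x * norm f" for f
      using norm_blinfun[of f x] by (simp add: mult.commute)
    then have "norm (real_bidual_embedding x) \<le> norm x"
      by (intro norm_blinfun_bound) auto
    then have "(\<Sum>n. ennreal (norm (blinfun_apply (real_bidual_embedding x) (z n)))) \<le> ennreal (norm x)"
      by (intro suminf_evaluation_le[where ap = blinfun_apply and z = z, OF assms])
        (simp_all add: blinfun.scaleR_left)
    then show ?thesis by simp
  qed
  have "pointwise_sum z (\<lambda>n. c * a n + d * b n) = c *\<^sub>R pointwise_sum z a + d *\<^sub>R pointwise_sum z b"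
    if "\<forall>n. norm (a n) \<le> 1" "\<forall>n. norm (b n) \<le> 1" for a b and c d :: real
    using that pointwise_sum_linear_apply[OF pw]
    by (intro blinfun_eqI) (simp add: blinfun.add_left blinfun.scaleR_left)
  then show ?thesis
    using pointwise_sum_indicator[OF pw] norm_pointwise_sum[OF pw]
    by (intro exI[of _ "pointwise_sum z"]) (simp add: blinfun.add_right blinfun.scaleR_right)
qed

lemma complex_dual_apply_scaleC: "complex_dual_apply f (c *\<^sub>C x) = c * complex_dual_apply f x"
  by transfer simp

lemma norm_complex_dual_apply: "norm (complex_dual_apply f x) \<le> norm f * norm x"
  by transfer (rule norm_blinfun)

text \<open>
  The sums are taken among the bounded real-linear maps into \<open>\<complex>\<close>; complex homogeneity survives
  because it holds term by term.
\<close>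

lemma complex_synthesis:
  fixes z :: "nat \<Rightarrow> 'a::complex_normed_vector complex_dual"
  assumes "(SUP f \<in> cball 0 1. \<Sum>n. ennreal (norm (complex_dual_apply f (z n)))) \<le> 1"
  shows "\<exists>T. (\<forall>n. T (indicator {n}) = z n) \<and>
    (\<forall>a. (\<forall>n. norm (a n) \<le> 1) \<longrightarrow> norm (T a) \<le> 1) \<and>
    (\<forall>f a b c d. (\<forall>n. norm (a n) \<le> 1) \<longrightarrow> (\<forall>n. norm (b n) \<le> 1) \<longrightarrow>
      complex_dual_apply f (T (\<lambda>n. c * a n + d * b n))
        = c * complex_dual_apply f (T a) + d * complex_dual_apply f (T b))"
proof -
  define w where "w n = blinfun_of_dual (z n)" for n
  have w_scaleC: "blinfun_apply (w n) (c *\<^sub>C x) = c * blinfun_apply (w n) x" for n c x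
    using blinfun_of_dual[of "z n"] by (simp add: w_def)
  have pw: "(\<Sum>n. ennreal (norm (blinfun_apply (w n) x))) \<le> ennreal (norm x)" for x
  proof -
    have "norm (complex_bidual_embedding x) \<le> norm x"
    proof -
      have "norm (blinfun_of_dual (complex_bidual_embedding x)) \<le> norm x"
        using norm_complex_dual_apply[of _ x]
        by (intro norm_blinfun_bound) (auto simp: mult.commute simp flip: complex_dual_apply.rep_eq)
      then show ?thesis by (simp add: norm_complex_dual.rep_eq)
    qed
    moreover have "complex_dual_apply (r *\<^sub>R f) u = r *\<^sub>R complex_dual_apply f u"
      for r f and u :: "'a complex_dual"
      by transfer (rule blinfun.scaleR_left)
    ultimately have "(\<Sum>n. ennreal (norm (complex_dual_apply (complex_bidual_embedding x) (z n))))
        \<le> ennreal (norm x)"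
      by (intro suminf_evaluation_le[where ap = complex_dual_apply and z = z, OF assms]) simp_all
    then show ?thesis
      by (simp add: w_def flip: complex_dual_apply.rep_eq)
  qed
  define T where "T a = dual_of_blinfun (pointwise_sum w a)" for a
  have T: "blinfun_of_dual (T a) = pointwise_sum w a" if "\<And>n. norm (a n) \<le> K" for a and K :: real
  proof -
    have "blinfun_apply (pointwise_sum w a) (c *\<^sub>C x) = c * blinfun_apply (pointwise_sum w a) x" for c x
      using summable_weighted[OF pw that]
      by (simp add: pointwise_sum_apply[OF pw that] w_scaleC mult.left_commute suminf_mult)
    then show ?thesis
      unfolding T_def by (intro dual_of_blinfun_inverse) simp
  qed
  show ?thesis
  proof (intro exI[of _ T] conjI allI impI)
    show "T (indicator {n}) = z n" for n
      by (simp add: T_def pointwise_sum_indicator[OF pw] w_def blinfun_of_dual_inverse)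
    show "norm (T a) \<le> 1" if "\<forall>n. norm (a n) \<le> 1" for a
      using that norm_pointwise_sum[OF pw, of a 1] T[of a 1] by (simp add: norm_complex_dual.rep_eq)
    fix f :: "'a complex_dual complex_dual" and a b :: "nat \<Rightarrow> complex" and c d :: complex
    assume ab: "\<forall>n. norm (a n) \<le> 1" "\<forall>n. norm (b n) \<le> 1"
    have bd: "norm (c * a n + d * b n) \<le> norm c + norm d" for n
      using mult_left_le[of "norm (a n)" "norm c"] mult_left_le[of "norm (b n)" "norm d"] ab
      by (intro norm_triangle_le) (simp add: norm_mult add_mono)
    have "blinfun_of_dual (T (\<lambda>n. c * a n + d * b n)) = blinfun_of_dual (c *\<^sub>C T a + d *\<^sub>C T b)"
      using ab T[of a 1] T[of b 1] pointwise_sum_linear_apply[OF pw]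
      by (intro blinfun_eqI)
        (simp add: T[OF bd] plus_complex_dual.rep_eq scaleC_complex_dual.rep_eq blinfun.add_left)
    then have "T (\<lambda>n. c * a n + d * b n) = c *\<^sub>C T a + d *\<^sub>C T b"
      by (simp add: blinfun_of_dual_inject)
    moreover have "complex_dual_apply f (u + u') = complex_dual_apply f u + complex_dual_apply f u'" for u u'
      by transfer (rule blinfun.add_right)
    ultimately show "complex_dual_apply f (T (\<lambda>n. c * a n + d * b n))
        = c * complex_dual_apply f (T a) + d * complex_dual_apply f (T b)"
      by (simp add: complex_dual_apply_scaleC)
  qed
qed

section \<open>The quantitative inequality\<close>

lemma wck_range_le_half_delta:
  fixes ap :: "'d::real_normed_vector \<Rightarrow> 'z::real_normed_vector \<Rightarrow> 'k::real_normed_field"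
    and ap' :: "'dd::metric_space \<Rightarrow> 'e \<Rightarrow> 'l::topological_space"
  assumes "wck J ap' (range x) \<le> ennreal C * eta ap (range x)"
    and "eta ap (range x) \<le> ennreal (1/2) * delta_weak_star ap x"
    and "C > 0"
  shows "wck J ap' (range x) \<le> ennreal (1/2 * C) * delta_weak_star ap x"
proof -
  have "wck J ap' (range x) \<le> ennreal C * (ennreal (1/2) * delta_weak_star ap x)"
    using assms(1,2) by (meson mult_left_mono order.trans zero_le)
  also have "\<dots> = ennreal (1/2 * C) * delta_weak_star ap x"
    using \<open>C > 0\<close> by (subst mult.commute[of "1/2" C]) (simp only: ennreal_mult mult.assoc)
  finally show ?thesis .
qed

theorem corollary5p2:
  fixes C :: real
  assumes "C > 0"
  shows
    "((\<forall>K :: (('a::banach \<Rightarrow>\<^sub>L real) \<Rightarrow>\<^sub>L real) set. bounded K \<longrightarrow>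
          wck real_bidual_embedding blinfun_apply K \<le> ennreal C * eta blinfun_apply K)
      \<longrightarrow>
      (\<forall>x :: nat \<Rightarrow> (('a \<Rightarrow>\<^sub>L real) \<Rightarrow>\<^sub>L real). bounded (range x) \<longrightarrow>
          wck real_bidual_embedding blinfun_apply (range x)
            \<le> ennreal (1/2 * C) * delta_weak_star blinfun_apply x))
    \<and>
     ((\<forall>K :: 'b::complex_banach complex_dual complex_dual set. bounded K \<longrightarrow>
          wck complex_bidual_embedding complex_dual_apply K \<le> ennreal C * eta complex_dual_apply K)
      \<longrightarrow>
      (\<forall>x :: nat \<Rightarrow> 'b complex_dual complex_dual. bounded (range x) \<longrightarrow>
          wck complex_bidual_embedding complex_dual_apply (range x)
            \<le> ennreal (1/2 * C) * delta_weak_star complex_dual_apply x))"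
proof (intro conjI impI allI)
  fix x :: "nat \<Rightarrow> (('a \<Rightarrow>\<^sub>L real) \<Rightarrow>\<^sub>L real)"
  assume hyp: "\<forall>K :: (('a \<Rightarrow>\<^sub>L real) \<Rightarrow>\<^sub>L real) set. bounded K \<longrightarrow>
      wck real_bidual_embedding blinfun_apply K \<le> ennreal C * eta blinfun_apply K"
    and x: "bounded (range x)"
  show "wck real_bidual_embedding blinfun_apply (range x)
      \<le> ennreal (1/2 * C) * delta_weak_star blinfun_apply x"
    by (rule wck_range_le_half_delta
        [OF hyp[rule_format, OF x] eta_range_le_half_delta[OF norm_blinfun real_synthesis x] assms])
next
  fix x :: "nat \<Rightarrow> 'b complex_dual complex_dual"
  assume hyp: "\<forall>K :: 'b complex_dual complex_dual set. bounded K \<longrightarrow>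
      wck complex_bidual_embedding complex_dual_apply K \<le> ennreal C * eta complex_dual_apply K"
    and x: "bounded (range x)"
  show "wck complex_bidual_embedding complex_dual_apply (range x)
      \<le> ennreal (1/2 * C) * delta_weak_star complex_dual_apply x"
    by (rule wck_range_le_half_delta
        [OF hyp[rule_format, OF x]
          eta_range_le_half_delta[OF norm_complex_dual_apply complex_synthesis x] assms])
qed

end
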